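(* Let $\mathcal H$ be a Hilbert space and let $\{g_n\}_{n=0}^\infty$ be a normalized Bessel sequence in $\mathcal H$. Then there exists a sequence $\{e_n\}_{n=0}^\infty$ of unit vectors in $\mathcal H$ such that $$g_0=e_0,\qquad g_n=e_n-\sum_{i=0}^{n-1}\langle e_n,e_i\rangle g_i\quad (n\ge 1).$$
   Context: Hilbert spaces are complex, with inner product linear in the first variable. A sequence $\{g_n\}_{n=0}^\infty$ in $\mathcal H$ is a Bessel sequence if $\sum_{n=0}^\infty |\langle x,g_n\rangle|^2\le \|x\|^2$ for all $x\in\mathcal H$ (Bessel bound $1$); it is a normalized Bessel sequence if in addition $\|g_0\|=1$. *)

theory Defs
  imports "HOL-Analysis.Analysis"
begin

class complex_vector = real_vector +
  fixes scaleC :: "complex \<Rightarrow> 'a \<Rightarrow> 'a"  (infixr "*\<^sub>C" 75)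
  assumes scaleC_add_right: "a *\<^sub>C (x + y) = a *\<^sub>C x + a *\<^sub>C y"
    and scaleC_add_left: "(a + b) *\<^sub>C x = a *\<^sub>C x + b *\<^sub>C x"
    and scaleC_scaleC: "a *\<^sub>C (b *\<^sub>C x) = (a * b) *\<^sub>C x"
    and scaleC_one: "1 *\<^sub>C x = x"
    and scaleR_scaleC: "r *\<^sub>R x = complex_of_real r *\<^sub>C x"

text \<open>The inner product is linear in its first argument and conjugate-linear in the second.
  Basing the class on \<^class>\<open>real_normed_vector\<close> is no restriction: by the last axiom the norm is
  the one induced by the inner product, so the norm axioms follow from the other ones.\<close>

class complex_inner = complex_vector + real_normed_vector +
  fixes cinner :: "'a \<Rightarrow> 'a \<Rightarrow> complex"
  assumes cinner_commute: "cinner x y = cnj (cinner y x)"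
    and cinner_add_left: "cinner (x + y) z = cinner x z + cinner y z"
    and cinner_scaleC_left: "cinner (a *\<^sub>C x) y = a * cinner x y"
    and cinner_ge_zero: "0 \<le> Re (cinner x x)"
    and cinner_eq_zero_iff: "cinner x x = 0 \<longleftrightarrow> x = 0"
    and norm_eq_sqrt_cinner: "norm x = sqrt (Re (cinner x x))"

class complex_hilbert_space = complex_inner + complete_space

instantiation complex :: complex_hilbert_space
begin

definition scaleC_complex :: "complex \<Rightarrow> complex \<Rightarrow> complex"
  where "scaleC_complex a x = a * x"

definition cinner_complex :: "complex \<Rightarrow> complex \<Rightarrow> complex"
  where "cinner_complex x y = x * cnj y"

instance
  by standard
    (auto simp: scaleC_complex_def cinner_complex_def algebra_simps scaleR_conv_of_real
      cmod_def power2_eq_square)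

end

text \<open>Bessel sequences with Bessel bound 1. Summability is stated explicitly because
  \<^const>\<open>suminf\<close> is unspecified on divergent series.\<close>

definition bessel_sequence :: "(nat \<Rightarrow> 'a::complex_inner) \<Rightarrow> bool"
  where "bessel_sequence g \<longleftrightarrow>
    (\<forall>x. summable (\<lambda>n. (cmod (cinner x (g n)))\<^sup>2) \<and>
         (\<Sum>n. (cmod (cinner x (g n)))\<^sup>2) \<le> (norm x)\<^sup>2)"

definition normalized_bessel_sequence :: "(nat \<Rightarrow> 'a::complex_inner) \<Rightarrow> bool"
  where "normalized_bessel_sequence g \<longleftrightarrow> bessel_sequence g \<and> norm (g 0) = 1"

end

theory Submission
  imports Defs
begin

text \<open>
  Write \<open>T\<^sub>n x = x - (\<Sum>i<n. \<langle>x, e\<^sub>i\<rangle> g\<^sub>i)\<close>. The recursion asks for unit vectors with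
  \<open>T\<^sub>n e\<^sub>n = g\<^sub>n\<close>, and they are chosen one after the other: the point is that the equation
  \<open>T\<^sub>n y = g\<^sub>n\<close> always has a solution of norm exactly \<open>1\<close>.

  If \<open>e\<^sub>0, \<dots>, e\<^bsub>n-1\<^esub>\<close> already satisfy the recursion, then \<open>T\<^sub>n\<close> is the product of the
  projections onto the orthogonal complements of \<open>e\<^sub>0, \<dots>, e\<^bsub>n-1\<^esub>\<close> (its adjoint is the
  residual of the Kaczmarz iteration), and \<open>T\<^sub>n T\<^sub>n\<^sup>*\<close> is \<open>S\<^sub>n = I - (\<Sum>i<n. g\<^sub>i \<otimes> g\<^sub>i)\<close>
  (\<open>defect_factorization\<close>). The Bessel inequality for the first \<open>n + 1\<close> terms reads
  \<open>\<bar>\<langle>x, g\<^sub>n\<rangle>\<bar>\<^sup>2 \<le> \<langle>S\<^sub>n x, x\<rangle> = \<parallel>T\<^sub>n\<^sup>* x\<parallel>\<^sup>2\<close>. In particular \<open>g\<^sub>n\<close> is orthogonal to the kernel of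
  \<open>S\<^sub>n\<close>. Since \<open>S\<^sub>n\<close> is a self-adjoint finite-rank perturbation of the identity, its range is
  the full orthogonal complement of its kernel (\<open>defect_fredholm\<close>), so \<open>S\<^sub>n x = g\<^sub>n\<close> for
  some \<open>x\<close>. Then \<open>y = T\<^sub>n\<^sup>* x\<close> solves \<open>T\<^sub>n y = g\<^sub>n\<close>, and \<open>\<parallel>y\<parallel>\<^sup>2 = \<langle>g\<^sub>n, x\<rangle>\<close> together with the
  inequality above gives \<open>\<parallel>y\<parallel> \<le> 1\<close>. Finally \<open>T\<^sub>n\<close> kills \<open>e\<^bsub>n-1\<^esub>\<close>, so adding a multiple of
  \<open>e\<^bsub>n-1\<^esub>\<close> to \<open>y\<close> raises the norm to \<open>1\<close> without changing \<open>T\<^sub>n y\<close>.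
\<close>

section \<open>Algebra of the inner product\<close>

interpretation complex_vector: vector_space "scaleC :: complex \<Rightarrow> 'a \<Rightarrow> 'a::complex_vector"
  by standard (simp_all add: scaleC_add_right scaleC_add_left scaleC_scaleC scaleC_one)

lemma cinner_zero_left [simp]: "cinner 0 (y :: 'a::complex_inner) = 0"
  using cinner_scaleC_left[of 0 "0 :: 'a" y] by simp

lemma cinner_diff_left:
  fixes x y z :: "'a::complex_inner"
  shows "cinner (x - y) z = cinner x z - cinner y z"
  using cinner_add_left[of "x - y" y z] by simp

lemma cinner_sum_left: "cinner (\<Sum>i\<in>A. f i) (y :: 'a::complex_inner) = (\<Sum>i\<in>A. cinner (f i) y)"
  by (induction A rule: infinite_finite_induct) (simp_all add: cinner_add_left)

lemma cinner_diff_right: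
  fixes x y z :: "'a::complex_inner"
  shows "cinner z (x - y) = cinner z x - cinner z y"
  by (metis cinner_commute cinner_diff_left complex_cnj_diff)

lemma cinner_scaleC_right:
  fixes x y :: "'a::complex_inner"
  shows "cinner x (a *\<^sub>C y) = cnj a * cinner x y"
  by (metis cinner_commute cinner_scaleC_left complex_cnj_mult)

lemma cinner_sum_right: "cinner (y :: 'a::complex_inner) (\<Sum>i\<in>A. f i) = (\<Sum>i\<in>A. cinner y (f i))"
  by (subst cinner_commute) (simp add: cinner_sum_left flip: cinner_commute)

lemma cinner_self:
  fixes x :: "'a::complex_inner"
  shows "cinner x x = complex_of_real ((norm x)\<^sup>2)"
proof -
  have "Im (cinner x x) = 0"
    using arg_cong[OF cinner_commute[of x x], of Im] by simp
  then show ?thesis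
    by (simp add: complex_eq_iff norm_eq_sqrt_cinner cinner_ge_zero)
qed

section \<open>Finite-rank perturbations of the identity\<close>

text \<open>
  The three operators of the proof are instances of one: \<open>T\<^sub>n\<close> is \<open>defect e g n\<close>, its adjoint
  is \<open>defect g e n\<close>, and \<open>S\<^sub>n\<close> is \<open>defect g g n\<close>.
\<close>

definition defect :: "(nat \<Rightarrow> 'a) \<Rightarrow> (nat \<Rightarrow> 'a) \<Rightarrow> nat \<Rightarrow> 'a \<Rightarrow> 'a::complex_inner"
  where "defect a b n x = x - (\<Sum>i<n. cinner x (a i) *\<^sub>C b i)"

lemma defect_0 [simp]: "defect a b 0 x = x"
  by (simp add: defect_def)

lemma defect_Suc: "defect a b (Suc n) x = defect a b n x - cinner x (a n) *\<^sub>C b n"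
  by (simp add: defect_def)

lemma defect_diff: "defect a b n (x - y) = defect a b n x - defect a b n y"
  by (simp add: defect_def cinner_diff_left complex_vector.scale_left_diff_distrib sum_subtractf)

lemma defect_scaleC: "defect a b n (c *\<^sub>C x) = c *\<^sub>C defect a b n x"
  by (simp add: defect_def cinner_scaleC_left complex_vector.scale_right_diff_distrib
      complex_vector.scale_sum_right)

lemma defect_add: "defect a b n (x + y) = defect a b n x + defect a b n y"
  using defect_diff[of a b n "x + y" y] by (simp add: eq_diff_eq)

lemma defect_adjoint: "cinner (defect a b n x) y = cinner x (defect b a n y)"
proof -
  show ?thesis
    unfolding defect_def
    by (simp add: cinner_diff_left cinner_diff_right cinner_sum_left cinner_sum_right
        cinner_scaleC_left cinner_scaleC_right mult.commute flip: cinner_commute)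
qed

text \<open>
  The Fredholm alternative, by adding one rank-one term at a time. Let \<open>S\<close> be the operator
  for \<open>n\<close> and \<open>S' x = S x - \<langle>x, h\<rangle> h\<close> the one for \<open>n + 1\<close>. Either \<open>h\<close> is in the range of \<open>S\<close>,
  and then the range of \<open>S'\<close> is that of \<open>S\<close>, or loses the one dimension that the kernel
  gains; or \<open>h\<close> is not orthogonal to the kernel of \<open>S\<close>, and then the range gains the
  direction \<open>h\<close> that the kernel loses.
\<close>

lemma defect_fredholm:
  fixes h :: "nat \<Rightarrow> 'a::complex_inner"
  assumes "\<And>x. defect h h n x = 0 \<Longrightarrow> cinner x f = 0"
  shows "\<exists>x. defect h h n x = f"
  using assms
proof (induction n arbitrary: f)
  case 0
  then show ?case by simp
next
  case (Suc n)
  let ?S = "defect h h n" and ?S' = "defect h h (Suc n)"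
  show ?case
  proof (cases "\<exists>k. ?S k = h n")
    case True
    then obtain k where k: "?S k = h n" by blast
    have hk: "cinner x (h n) = cinner (?S x) k" for x
      by (simp add: defect_adjoint k)
    have "\<exists>u. ?S u = f"
    proof (rule Suc.IH)
      fix x assume "?S x = 0"
      then show "cinner x f = 0"
        by (intro Suc.prems) (simp add: defect_Suc hk)
    qed
    then obtain u where u: "?S u = f" by blast
    have S'k: "?S' k = (1 - cinner k (h n)) *\<^sub>C h n"
      by (simp add: defect_Suc k complex_vector.scale_left_diff_distrib)
    show ?thesis
    proof (cases "cinner k (h n) = 1")
      case True
      then have "cinner k f = 0"
        using S'k by (intro Suc.prems) simp
      then have "cinner f k = 0"
        by (subst cinner_commute) simp
      then have "?S' u = f"
        by (simp add: defect_Suc hk u)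
      then show ?thesis ..
    next
      case False
      \<comment> \<open>Now \<open>h n\<close> is in the range of \<open>S'\<close>; use it to cancel the rank-one term of \<open>S' u\<close>.\<close>
      define c where "c = cinner u (h n) / (1 - cinner k (h n))"
      have "c * (1 - cinner k (h n)) = cinner u (h n)"
        using False by (simp add: c_def)
      then have "?S' (u + c *\<^sub>C k) = ?S' u + cinner u (h n) *\<^sub>C h n"
        by (simp add: defect_add defect_scaleC S'k)
      also have "\<dots> = f"
        by (simp add: defect_Suc u)
      finally show ?thesis ..
    qed
  next
    case False
    then obtain z0 where z0: "?S z0 = 0" "cinner z0 (h n) \<noteq> 0"
      using Suc.IH[of "h n"] by blast
    define z where "z = inverse (cinner z0 (h n)) *\<^sub>C z0"
    have z: "?S z = 0" "cinner z (h n) = 1"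
      using z0 by (simp_all add: z_def defect_scaleC cinner_scaleC_left)
    define d where "d = cnj (cinner z f)"
    have "\<exists>u. ?S u = f - d *\<^sub>C h n"
    proof (rule Suc.IH)
      fix x assume x: "?S x = 0"
      \<comment> \<open>The component of \<open>x\<close> along \<open>z\<close> is removed to land in the kernel of \<open>S'\<close>.\<close>
      have "cinner (x - cinner x (h n) *\<^sub>C z) f = 0"
        by (rule Suc.prems)
          (simp add: defect_Suc defect_diff defect_scaleC cinner_diff_left cinner_scaleC_left x z)
      then show "cinner x (f - d *\<^sub>C h n) = 0"
        by (simp add: d_def cinner_diff_left cinner_diff_right cinner_scaleC_left
            cinner_scaleC_right mult.commute)
    qed
    then obtain u where u: "?S u = f - d *\<^sub>C h n" by blast
    have "?S' (u - (cinner u (h n) + d) *\<^sub>C z) = f"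
    proof -
      have "?S' (u - c *\<^sub>C z) = f - d *\<^sub>C h n - (cinner u (h n) - c) *\<^sub>C h n" for c
        by (simp add: defect_Suc defect_diff defect_scaleC u z cinner_diff_left cinner_scaleC_left
            complex_vector.scale_left_diff_distrib)
      from this[of "cinner u (h n) + d"] show ?thesis
        by simp
    qed
    then show ?thesis ..
  qed
qed

section \<open>Solving for the next unit vector\<close>

text \<open>
  The identity \<open>T\<^sub>n T\<^sub>n\<^sup>* = S\<^sub>n\<close>. For \<open>n \<ge> 1\<close> its core is that \<open>\<langle>T\<^sub>n\<^sup>* x, e\<^bsub>n-1\<^esub>\<rangle> = 0\<close>: each residual is
  orthogonal to the vector used last, because \<open>e\<^bsub>n-1\<^esub>\<close> has norm \<open>1\<close>.
\<close>

lemma defect_factorization: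
  fixes e g :: "nat \<Rightarrow> 'a::complex_inner"
  assumes "\<And>i. i < n \<Longrightarrow> norm (e i) = 1" "\<And>i. i < n \<Longrightarrow> defect e g i (e i) = g i"
  shows "defect e g n (defect g e n x) = defect g g n x"
  using assms
proof (induction n)
  case 0
  then show ?case by simp
next
  case (Suc n)
  have IH: "defect e g n (defect g e n x) = defect g g n x"
    using Suc by simp
  have g: "defect e g n (e n) = g n" and e: "cinner (e n) (e n) = 1"
    using Suc.prems by (simp_all add: cinner_self)
  have "cinner x (g n) = cinner (defect g e n x) (e n)"
    by (simp add: defect_adjoint g)
  then have "cinner (defect g e (Suc n) x) (e n) = 0"
    by (simp add: defect_Suc cinner_diff_left cinner_scaleC_left e)
  then have "defect e g (Suc n) (defect g e (Suc n) x) = defect e g n (defect g e (Suc n) x)"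
    by (simp add: defect_Suc)
  also have "\<dots> = defect g g (Suc n) x"
    by (simp add: defect_Suc[of g] defect_diff defect_scaleC IH g)
  finally show ?case .
qed

lemma norm_eq_one_on_ray:
  fixes y v :: "'a::real_normed_vector"
  assumes "norm y \<le> 1" "norm v = 1"
  shows "\<exists>t. norm (y + t *\<^sub>R v) = 1"
proof -
  have "norm (2 *\<^sub>R v) \<le> norm (y + 2 *\<^sub>R v) + norm y"
    using norm_triangle_ineq4[of "y + 2 *\<^sub>R v" y] by simp
  then have "1 \<le> norm (y + 2 *\<^sub>R v)"
    using assms by simp
  then have "\<exists>t\<ge>0. t \<le> 2 \<and> norm (y + t *\<^sub>R v) = 1"
    using assms by (intro IVT') (auto intro!: continuous_intros)
  then show ?thesis by blast
qed

lemma bessel_sequence_partial_sum_le: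
  assumes "bessel_sequence g"
  shows "(\<Sum>i<n. (cmod (cinner x (g i)))\<^sup>2) \<le> (norm x)\<^sup>2"
proof -
  have "(\<Sum>i<n. (cmod (cinner x (g i)))\<^sup>2) \<le> (\<Sum>i. (cmod (cinner x (g i)))\<^sup>2)"
    using assms by (intro sum_le_suminf) (auto simp: bessel_sequence_def)
  also have "\<dots> \<le> (norm x)\<^sup>2"
    using assms by (simp add: bessel_sequence_def)
  finally show ?thesis .
qed

lemma cinner_defect_self:
  "cinner (defect g g n x) x = complex_of_real ((norm x)\<^sup>2 - (\<Sum>i<n. (cmod (cinner x (g i)))\<^sup>2))"
proof -
  have "cinner x (g i) * cinner (g i) x = complex_of_real ((cmod (cinner x (g i)))\<^sup>2)" for i
    by (metis cinner_commute complex_norm_square)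
  then show ?thesis
    by (simp add: defect_def cinner_diff_left cinner_sum_left cinner_scaleC_left cinner_self)
qed

text \<open>
  The step of the construction: solve \<open>S\<^sub>n x = g\<^sub>n\<close>, pass to \<open>y = T\<^sub>n\<^sup>* x\<close>, and move along the
  direction \<open>e\<^bsub>n-1\<^esub>\<close> in the kernel of \<open>T\<^sub>n\<close> to reach norm \<open>1\<close>. For \<open>n = 0\<close> no such direction
  is available, which is why \<open>g\<^sub>0\<close> itself has to be a unit vector.
\<close>

lemma next_unit_vector:
  fixes e g :: "nat \<Rightarrow> 'a::complex_inner"
  assumes bessel: "bessel_sequence g" and g0: "norm (g 0) = 1"
    and unit: "\<And>i. i < n \<Longrightarrow> norm (e i) = 1"
    and rec: "\<And>i. i < n \<Longrightarrow> defect e g i (e i) = g i"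
  shows "\<exists>v. norm v = 1 \<and> defect e g n v = g n"
proof (cases n)
  case 0
  then show ?thesis using g0 by auto
next
  case (Suc m)
  \<comment> \<open>The right-hand side is what the first \<open>n\<close> terms of the Bessel sum leave of \<open>\<parallel>x\<parallel>\<^sup>2\<close>.\<close>
  have bound: "(cmod (cinner x (g n)))\<^sup>2 \<le> Re (cinner (defect g g n x) x)" for x
    using bessel_sequence_partial_sum_le[OF bessel, where n = "Suc n" and x = x]
    by (simp add: cinner_defect_self)
  have "\<exists>x. defect g g n x = g n"
  proof (rule defect_fredholm)
    fix x assume "defect g g n x = 0"
    then show "cinner x (g n) = 0"
      using bound[of x] by simp
  qed
  then obtain x where x: "defect g g n x = g n" by blast
  define y where "y = defect g e n x"
  have y: "defect e g n y = g n"
    unfolding y_def using defect_factorization[of n e g x] unit rec x by simp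
  have norm_y: "cinner x (g n) = complex_of_real ((norm y)\<^sup>2)"
    using defect_adjoint[of g e n x y] y by (simp only: cinner_self y_def[symmetric])
  have "((norm y)\<^sup>2)\<^sup>2 \<le> (norm y)\<^sup>2"
  proof -
    have "cinner (g n) x = complex_of_real ((norm y)\<^sup>2)"
      by (subst cinner_commute) (simp add: norm_y)
    then show ?thesis
      using bound[of x] by (simp add: x norm_y norm_power)
  qed
  then have "norm y \<le> 1"
    using power_strict_increasing[of 2 4 "norm y"] by (fastforce simp flip: power_mult not_less)
  moreover have em: "norm (e m) = 1" using unit Suc by simp
  ultimately obtain t where t: "norm (y + t *\<^sub>R e m) = 1"
    using norm_eq_one_on_ray by blast
  have "defect e g n (e m) = 0"
    using rec[of m] em by (simp add: Suc defect_Suc cinner_self)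
  then have "defect e g n (y + t *\<^sub>R e m) = g n"
    by (simp add: scaleR_scaleC defect_add defect_scaleC y)
  with t show ?thesis by blast
qed

theorem theorem1:
  fixes g :: "nat \<Rightarrow> 'a::complex_hilbert_space"
  assumes "normalized_bessel_sequence g"
  shows "\<exists>e :: nat \<Rightarrow> 'a.
    (\<forall>n. norm (e n) = 1) \<and>
    g 0 = e 0 \<and>
    (\<forall>n\<ge>1. g n = e n - (\<Sum>i<n. cinner (e n) (e i) *\<^sub>C g i))"
proof -
  have g: "bessel_sequence g" "norm (g 0) = 1"
    using assms by (simp_all add: normalized_bessel_sequence_def)
  have "\<exists>e. \<forall>n. norm (e n) = 1 \<and> defect e g n (e n) = g n"
  proof (rule dependent_wf_choice[where R = less_than
        and P = "\<lambda>e n v. norm v = 1 \<and> defect e g n v = g n"])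
    show "wf less_than" by simp
    show "(norm v = 1 \<and> defect e g n v = g n) = (norm v = 1 \<and> defect e' g n v = g n)"
      if "\<And>i. (i, n) \<in> less_than \<Longrightarrow> e i = e' i" for e e' n v
      using that by (simp add: defect_def)
    show "\<exists>v. norm v = 1 \<and> defect e g n v = g n"
      if "\<And>i. (i, n) \<in> less_than \<Longrightarrow> norm (e i) = 1 \<and> defect e g i (e i) = g i" for e n
      using that by (intro next_unit_vector[OF g]) auto
  qed
  then obtain e where e: "\<And>n. norm (e n) = 1" "\<And>n. defect e g n (e n) = g n"
    by blast
  have "g 0 = e 0"
    using e(2)[of 0] by simp
  moreover have "g n = e n - (\<Sum>i<n. cinner (e n) (e i) *\<^sub>C g i)" for n
    using e(2)[of n] by (simp add: defect_def)
  ultimately show ?thesis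
    using e(1) by blast
qed

end
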